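(* The following two statements hold. (1) Let $G$ be a finite metanilpotent group and let $F$ be its prime graph. Then the complement graph $\overline{F}$ is bipartite. (2) If $F$ is a finite simple graph such that $\overline{F}$ is bipartite, then there exists a finite group of square-free order whose prime graph is isomorphic to $F$.
   Context: All groups are finite and all graphs are simple. The prime graph (Gruenberg-Kegel graph) of a finite group $G$ has as vertices the primes dividing $|G|$, with two distinct primes $p,q$ adjacent if and only if $G$ contains an element of order $pq$. A group $G$ is metanilpotent if it has a nilpotent normal subgroup $N$ with $G/N$ nilpotent. $\overline{F}$ denotes the complement of the graph $F$. *)

theory Defs
  imports
    "HOL-Algebra.Generated_Groups"
    "HOL-Algebra.Multiplicative_Group"
    "HOL-Computational_Algebra.Squarefree"
    "Graph_Theory.Digraph_Isomorphism"
    "Graph_Theory.Pair_Digraph"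
begin

fun lower_central_series :: "('a, 'b) monoid_scheme \<Rightarrow> nat \<Rightarrow> 'a set" where
  "lower_central_series G 0 = carrier G"
| "lower_central_series G (Suc n) =
     generate G (\<Union>x \<in> lower_central_series G n. \<Union>y \<in> carrier G.
       {x \<otimes>\<^bsub>G\<^esub> y \<otimes>\<^bsub>G\<^esub> inv\<^bsub>G\<^esub> x \<otimes>\<^bsub>G\<^esub> inv\<^bsub>G\<^esub> y})"

definition nilpotent :: "('a, 'b) monoid_scheme \<Rightarrow> bool" where
  "nilpotent G \<longleftrightarrow> group G \<and> (\<exists>n. lower_central_series G n = {\<one>\<^bsub>G\<^esub>})"

definition metanilpotent :: "('a, 'b) monoid_scheme \<Rightarrow> bool" where
  "metanilpotent G \<longleftrightarrow>
     group G \<and> (\<exists>N. N \<lhd> G \<and> nilpotent (G\<lparr>carrier := N\<rparr>) \<and> nilpotent (G Mod N))"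

text \<open>
  A finite simple graph is a \<^locale>\<open>pair_graph\<close>, in which an edge between \<open>u\<close> and \<open>v\<close> is the
  pair of arcs \<open>(u, v)\<close> and \<open>(v, u)\<close>.
\<close>

definition prime_graph :: "('a, 'b) monoid_scheme \<Rightarrow> nat pair_pre_digraph" where
  "prime_graph G =
     (let V = {p. Factorial_Ring.prime p \<and> p dvd order G} in
      \<lparr>pverts = V,
       parcs = {(p, q). p \<in> V \<and> q \<in> V \<and> p \<noteq> q \<and> (\<exists>x \<in> carrier G. group.ord G x = p * q)}\<rparr>)"

definition complement_graph :: "'v pair_pre_digraph \<Rightarrow> 'v pair_pre_digraph" where
  "complement_graph F =
     \<lparr>pverts = pverts F,
      parcs = {(u, v). u \<in> pverts F \<and> v \<in> pverts F \<and> u \<noteq> v \<and> (u, v) \<notin> parcs F}\<rparr>"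

text \<open>The two parts may be empty, so graphs with at most one vertex are bipartite.\<close>

definition bipartite :: "'v pair_pre_digraph \<Rightarrow> bool" where
  "bipartite F \<longleftrightarrow>
     (\<exists>U W. pverts F = U \<union> W \<and> U \<inter> W = {} \<and> parcs F \<subseteq> U \<times> W \<union> W \<times> U)"

lemma pair_graph_prime_graph:
  assumes "group G" and "finite (carrier G)"
  shows "pair_graph (prime_graph G)"
proof -
  have "order G > 0"
    using assms by (simp add: group.is_monoid monoid.order_gt_0_iff_finite)
  then have fin: "finite {p. Factorial_Ring.prime p \<and> p dvd order G}"
    by (auto intro: finite_subset[OF _ finite_divisors_nat])
  then have "finite (parcs (prime_graph G))"
    by (intro finite_subset[OF _ finite_cartesian_product[OF fin fin]])
      (auto simp: prime_graph_def Let_def)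
  with fin show ?thesis
    by unfold_locales
      (auto simp: prime_graph_def Let_def symmetric_def mult.commute intro!: symI)
qed

lemma pair_graph_complement_graph:
  assumes "pair_graph F"
  shows "pair_graph (complement_graph F)"
proof -
  interpret pair_graph F by fact
  have "finite (parcs (complement_graph F))"
    by (rule finite_subset[OF _ finite_cartesian_product[OF pair_finite_verts pair_finite_verts]])
      (auto simp: complement_graph_def)
  moreover have "(u, v) \<in> parcs F \<longleftrightarrow> (v, u) \<in> parcs F" for u v
    using pair_sym_arcs by (auto simp: symmetric_def dest: symD)
  ultimately show ?thesis
    using pair_finite_verts
    by unfold_locales (auto simp: complement_graph_def symmetric_def intro!: symI)
qed

end

theory Submission
  imports
    Defs
    "HOL-Algebra.Sylow"
    "HOL-Algebra.Weak_Morphisms"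
    "HOL-Number_Theory.Pocklington"
    "HOL-Library.Nat_Bijection"
begin

text \<open>
  For the first half, let \<open>N\<close> be a nilpotent normal subgroup of \<open>G\<close> with nilpotent quotient, and split
  the primes dividing the order of \<open>G\<close> into those that divide \<open>|N|\<close> and those that do not. Elements of
  coprime order in a nilpotent group commute (\<open>nilpotent_coprime_ord_commute\<close>), so by Cauchy's theorem
  any two prime divisors of the order of a nilpotent group are adjacent in its prime graph. Two primes
  of the first kind are therefore adjacent inside \<open>N\<close>. Two primes of the second kind divide the order
  of \<open>G/N\<close>, are adjacent there, and an element of order \<open>p * q\<close> of the quotient has a preimage one of
  whose powers has order \<open>p * q\<close>. Hence each of the two classes is a clique.

  For the second half, let the vertices of \<open>F\<close> be split into two cliques \<open>U\<close> and \<open>W\<close>. Label the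
  vertices of \<open>W\<close> by distinct primes \<open>q w\<close> and those of \<open>U\<close> by distinct primes \<open>p u\<close>, and let \<open>P\<close> and \<open>Q\<close> be
  the products of the two families. A semidirect product of the cyclic group of order \<open>P\<close> by the
  cyclic group of order \<open>Q\<close>, the latter acting through powers of some \<open>r\<close>, has square-free order \<open>P * Q\<close>,
  and its prime graph contains both cliques. It has an element of order \<open>p u * q w\<close> exactly
  when the subgroup of order \<open>q w\<close> acts trivially modulo \<open>p u\<close>, which means \<open>r ^ (Q div q w)\<close> is 1 modulo
  \<open>p u\<close>. If the residues modulo \<open>p u\<close> contain an element \<open>a u\<close> of multiplicative order \<open>Q\<close>, then raising
  \<open>a u\<close> to the product of all \<open>q w\<close> with \<open>w\<close> adjacent to \<open>u\<close> kills precisely the actions of those \<open>q w\<close>,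
  and the Chinese remainder theorem combines these residues into a single \<open>r\<close>.

  What remains is a supply of primes \<open>p\<close> modulo which some residue has order \<open>Q\<close>. The labels \<open>q w\<close> are
  chosen larger than the number of vertices in \<open>W\<close>, which makes the sum of their reciprocals less than
  1; under this condition \<open>exists_prime_with_given_order\<close> gives arbitrarily large such \<open>p\<close> by comparing
  the sizes of \<open>a ^ Q - 1\<close> and of the product of the \<open>a ^ (Q div q) - 1\<close>.
\<close>

section \<open>Commuting elements in nilpotent groups\<close>

context group
begin

lemma mult_inv_cancel:
  assumes "x \<in> carrier G" "z \<in> carrier G"
  shows "x \<otimes> (inv x \<otimes> z) = z" "inv x \<otimes> (x \<otimes> z) = z"
  using assms by (simp_all flip: m_assoc)

text \<open>
  A commutation relation \<open>a b = c b a\<close> in which \<open>c\<close> commutes with \<open>a\<close> is linear in \<open>a\<close>: moving \<open>b\<close> past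
  each of the \<open>k\<close> factors \<open>a\<close> produces one \<open>c\<close>. Putting \<open>k = ord a\<close> bounds the order of \<open>c\<close>.
\<close>

lemma pow_mult_commutator_power:
  assumes "a \<in> carrier G" "b \<in> carrier G" "c \<in> carrier G"
    and ab: "a \<otimes> b = c \<otimes> (b \<otimes> a)" and ca: "c \<otimes> a = a \<otimes> c"
  shows "a [^] (k::nat) \<otimes> b = c [^] k \<otimes> (b \<otimes> a [^] k)"
proof (induction k)
  case (Suc k)
  have ack: "a \<otimes> c [^] k = c [^] k \<otimes> a"
    using group_commutes_pow[OF ca] assms by simp
  have "a [^] Suc k \<otimes> b = a \<otimes> (a [^] k \<otimes> b)"
    using assms nat_pow_Suc2[of a k] by (simp add: m_assoc del: nat_pow_Suc)
  also have "\<dots> = (a \<otimes> c [^] k) \<otimes> (b \<otimes> a [^] k)"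
    using assms by (simp add: Suc m_assoc)
  also have "\<dots> = c [^] k \<otimes> ((a \<otimes> b) \<otimes> a [^] k)"
    using assms(1-3) by (simp add: ack m_assoc)
  also have "(a \<otimes> b) \<otimes> a [^] k = c \<otimes> (b \<otimes> a [^] Suc k)"
    unfolding ab nat_pow_Suc2[OF assms(1)] using assms(1-3) by (simp add: m_assoc)
  also have "c [^] k \<otimes> \<dots> = c [^] Suc k \<otimes> (b \<otimes> a [^] Suc k)"
    using assms(1-3) by (simp add: m_assoc)
  finally show ?case .
qed (use assms in simp)

lemma ord_commutator_dvd:
  assumes "a \<in> carrier G" "b \<in> carrier G" "c \<in> carrier G"
    and "a \<otimes> b = c \<otimes> (b \<otimes> a)" "c \<otimes> a = a \<otimes> c"
  shows "ord c dvd ord a"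
proof -
  have "b = c [^] ord a \<otimes> b"
    using pow_mult_commutator_power[OF assms, of "ord a"] assms by simp
  then have "c [^] ord a = \<one>"
    using assms by (metis l_one nat_pow_closed one_closed right_cancel)
  then show ?thesis
    using assms by (simp add: pow_eq_id)
qed

text \<open>
  The roles of \<open>a\<close> and \<open>b\<close> can be exchanged by passing to the inverse of \<open>c\<close>, so the order of \<open>c\<close> divides
  the orders of both.
\<close>

lemma central_commutator_eq_one:
  assumes "a \<in> carrier G" "b \<in> carrier G" "c \<in> carrier G"
    and ab: "a \<otimes> b = c \<otimes> (b \<otimes> a)" and ca: "c \<otimes> a = a \<otimes> c" and cb: "c \<otimes> b = b \<otimes> c"
    and "coprime (ord a) (ord b)"
  shows "c = \<one>"
proof -
  have "b \<otimes> a = inv c \<otimes> (a \<otimes> b)"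
    using assms by (simp add: ab inv_solve_left)
  moreover have "inv c \<otimes> b = b \<otimes> inv c"
    using assms by (metis cb inv_closed inv_solve_left inv_solve_right m_assoc m_closed)
  ultimately have "ord (inv c) dvd ord b"
    using assms by (intro ord_commutator_dvd) auto
  moreover have "ord c dvd ord a"
    using assms by (intro ord_commutator_dvd)
  ultimately have "ord c = 1"
    using assms by (metis coprime_common_divisor_nat ord_inv coprime_def is_unit_gcd_iff nat_dvd_1_iff_1)
  then show ?thesis
    using assms ord_eq_1 by blast
qed

text \<open>
  The generating commutators are permuted by conjugation, because conjugation is an automorphism
  that preserves the preceding term of the series.
\<close>

lemma lower_central_series_normal: "lower_central_series G n \<lhd> G"
proof (induction n)
  case 0
  then show ?case
    by (simp add: normal_inv_iff subgroup_self)
next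
  case (Suc n)
  let ?L = "lower_central_series G n"
  interpret L: normal ?L G by fact
  show ?case
    unfolding lower_central_series.simps
  proof (rule normal_generateI)
    fix h g
    assume "h \<in> (\<Union>x\<in>?L. \<Union>y\<in>carrier G. {x \<otimes> y \<otimes> inv x \<otimes> inv y})" and g: "g \<in> carrier G"
    then obtain x y where x: "x \<in> ?L" and y: "y \<in> carrier G" and h: "h = x \<otimes> y \<otimes> inv x \<otimes> inv y"
      by auto
    have xG: "x \<in> carrier G" using x L.mem_carrier by blast
    have "g \<otimes> h \<otimes> inv g =
        (g \<otimes> x \<otimes> inv g) \<otimes> (g \<otimes> y \<otimes> inv g) \<otimes> inv (g \<otimes> x \<otimes> inv g) \<otimes> inv (g \<otimes> y \<otimes> inv g)"
      using xG y g unfolding h by (simp add: m_assoc inv_mult_group mult_inv_cancel)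
    moreover have "g \<otimes> x \<otimes> inv g \<in> ?L"
      using x g L.inv_op_closed2 by blast
    moreover have "g \<otimes> y \<otimes> inv g \<in> carrier G"
      using y g by simp
    ultimately show "g \<otimes> h \<otimes> inv g \<in> (\<Union>x\<in>?L. \<Union>y\<in>carrier G. {x \<otimes> y \<otimes> inv x \<otimes> inv y})"
      by blast
  qed (auto dest: L.mem_carrier)
qed

lemma ord_rcoset_dvd:
  assumes "N \<lhd> G" "x \<in> carrier G"
  shows "group.ord (G Mod N) (N #> x) dvd ord x"
proof -
  interpret N: normal N G by fact
  interpret Q: group "G Mod N" by (rule N.factorgroup_is_group)
  interpret h: group_hom G "G Mod N" "\<lambda>a. N #> a"
    by unfold_locales (rule N.r_coset_hom_Mod)
  have "(N #> x) [^]\<^bsub>G Mod N\<^esub> ord x = N #> (x [^] ord x)"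
    using assms by (simp add: h.hom_nat_pow del: pow_ord_eq_1)
  then show ?thesis
    using assms h.hom_one by (simp flip: Q.pow_eq_id)
qed

lemma rcoset_mult_commute:
  assumes "N \<lhd> G" "x \<in> carrier G" "y \<in> carrier G" "x \<otimes> y \<otimes> inv x \<otimes> inv y \<in> N"
  shows "N #> (x \<otimes> y) = N #> (y \<otimes> x)"
proof -
  interpret N: normal N G by fact
  have "x \<otimes> y = (x \<otimes> y \<otimes> inv x \<otimes> inv y) \<otimes> (y \<otimes> x)"
    using assms by (simp add: m_assoc mult_inv_cancel)
  also have "N #> \<dots> = N #> (x \<otimes> y \<otimes> inv x \<otimes> inv y) #> (y \<otimes> x)"
    using assms by (intro coset_mult_assoc[symmetric]) (auto simp: N.subset)
  also have "N #> (x \<otimes> y \<otimes> inv x \<otimes> inv y) = N"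
    using assms by (intro N.rcos_const) auto
  finally show ?thesis .
qed

text \<open>
  The commutator \<open>c\<close> of \<open>x\<close> and \<open>y\<close> is pushed down the lower central series. If \<open>c\<close> lies in one term, its
  image is central in the quotient of \<open>G\<close> by the next term \<open>N\<close>. The images of \<open>x\<close> and \<open>y\<close> still have coprime
  orders, so the image of \<open>c\<close> is trivial and \<open>c\<close> lies in \<open>N\<close>. The series ends in the trivial group.
\<close>

lemma nilpotent_coprime_ord_commute:
  assumes "nilpotent G" and x: "x \<in> carrier G" and y: "y \<in> carrier G"
    and cop: "coprime (ord x) (ord y)"
  shows "x \<otimes> y = y \<otimes> x"
proof -
  define c where "c = x \<otimes> y \<otimes> inv x \<otimes> inv y"
  have c: "c \<in> carrier G" and xy: "x \<otimes> y = c \<otimes> (y \<otimes> x)"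
    using x y by (auto simp: c_def m_assoc mult_inv_cancel)
  have "c \<in> lower_central_series G n" for n
  proof (induction n)
    case (Suc n)
    define N where "N = lower_central_series G (Suc n)"
    have N: "N \<lhd> G" unfolding N_def by (rule lower_central_series_normal)
    interpret N: normal N G by (rule N)
    interpret Q: group "G Mod N" by (rule N.factorgroup_is_group)
    have comm: "c \<otimes> g \<otimes> inv c \<otimes> inv g \<in> N" if "g \<in> carrier G" for g
      using Suc that unfolding N_def by (auto intro!: generate.incl)
    have mult: "(N #> g) \<otimes>\<^bsub>G Mod N\<^esub> (N #> h) = N #> (g \<otimes> h)"
      if "g \<in> carrier G" "h \<in> carrier G" for g h
      using that by (simp add: FactGroup_def N.rcos_sum)
    have cl: "N #> g \<in> carrier (G Mod N)" if "g \<in> carrier G" for g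
      using that by (auto simp: FactGroup_def RCOSETS_def)
    have "N #> c = \<one>\<^bsub>G Mod N\<^esub>"
    proof (rule Q.central_commutator_eq_one[of "N #> x" "N #> y"])
      have "group.ord (G Mod N) (N #> x) dvd ord x" "group.ord (G Mod N) (N #> y) dvd ord y"
        using N x y by (auto intro: ord_rcoset_dvd)
      then show "coprime (group.ord (G Mod N) (N #> x)) (group.ord (G Mod N) (N #> y))"
        using cop by (meson coprime_divisors)
      show "(N #> x) \<otimes>\<^bsub>G Mod N\<^esub> (N #> y) =
          (N #> c) \<otimes>\<^bsub>G Mod N\<^esub> ((N #> y) \<otimes>\<^bsub>G Mod N\<^esub> (N #> x))"
        by (simp only: mult x y c m_closed xy)
      show "(N #> c) \<otimes>\<^bsub>G Mod N\<^esub> (N #> x) = (N #> x) \<otimes>\<^bsub>G Mod N\<^esub> (N #> c)"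
        by (simp only: mult x c rcoset_mult_commute[OF N c x comm[OF x]])
      show "(N #> c) \<otimes>\<^bsub>G Mod N\<^esub> (N #> y) = (N #> y) \<otimes>\<^bsub>G Mod N\<^esub> (N #> c)"
        by (simp only: mult y c rcoset_mult_commute[OF N c y comm[OF y]])
    qed (use x y c in \<open>auto intro: cl\<close>)
    then have "N #> c = N" by (simp add: FactGroup_def)
    then show ?case
      using rcos_self[OF c N.subgroup_axioms] N_def by auto
  qed (use c in simp)
  then have "c = \<one>"
    using assms(1) by (auto simp: nilpotent_def)
  then show ?thesis
    using xy x y by simp
qed

end

section \<open>Prime graphs of metanilpotent groups\<close>

context group
begin

lemma ord_mult_coprime:
  assumes "x \<in> carrier G" "y \<in> carrier G" and xy: "x \<otimes> y = y \<otimes> x"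
    and cop: "coprime (ord x) (ord y)"
  shows "ord (x \<otimes> y) = ord x * ord y"
proof -
  have dvd: "ord u dvd ord (u \<otimes> v)"
    if uv: "u \<in> carrier G" "v \<in> carrier G" "u \<otimes> v = v \<otimes> u" "coprime (ord u) (ord v)" for u v
  proof -
    let ?m = "ord (u \<otimes> v) * ord v"
    have "u [^] ?m \<otimes> v [^] ?m = (u \<otimes> v) [^] ?m"
      using uv by (intro pow_mult_distrib[symmetric]) auto
    also have "\<dots> = \<one>"
      using uv by (simp add: pow_eq_id)
    also have "v [^] ?m = \<one>"
      using uv by (simp add: pow_eq_id)
    finally have "ord u dvd ?m"
      using uv by (simp add: pow_eq_id)
    then show ?thesis
      using uv by (simp add: coprime_dvd_mult_left_iff)
  qed
  have "ord x dvd ord (x \<otimes> y)" "ord y dvd ord (x \<otimes> y)"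
    using dvd[of x y] dvd[of y x] assms by (auto simp: coprime_commute)
  then have "ord x * ord y dvd ord (x \<otimes> y)"
    using cop by (simp add: divides_mult)
  then show ?thesis
    using ord_mul_divides[OF xy] assms by (simp add: dvd_antisym)
qed

lemma ord_subgroup:
  assumes "subgroup N G" "x \<in> N"
  shows "group.ord (G\<lparr>carrier := N\<rparr>) x = ord x"
proof -
  interpret N: group "G\<lparr>carrier := N\<rparr>"
    using assms subgroup_imp_group by blast
  show ?thesis
    unfolding N.ord_def ord_def by (simp flip: nat_pow_consistent)
qed

text \<open>
  Cauchy's theorem: a subgroup of order \<open>p\<close>, as given by Sylow's theorem for the exponent 1, consists
  of the identity and elements of order \<open>p\<close>.
\<close>

lemma cauchy_prime_order:
  assumes "finite (carrier G)" and p: "Factorial_Ring.prime p" "p dvd order G"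
  obtains x where "x \<in> carrier G" "ord x = p"
proof -
  obtain m where "order G = p ^ 1 * m"
    using p by auto
  then obtain H where H: "subgroup H G" "card H = p ^ 1"
    using sylow_thm[OF p(1) is_group _ assms(1)] by blast
  then have "\<not> H \<subseteq> {\<one>}"
    using p prime_gt_1_nat[of p] card_mono[of "{\<one>}" H] by auto
  then obtain x where x: "x \<in> H" "x \<noteq> \<one>"
    by blast
  interpret H: group "G\<lparr>carrier := H\<rparr>"
    using H subgroup_imp_group by blast
  have xG: "x \<in> carrier G" using x H subgroup.mem_carrier by fastforce
  have "ord x dvd p"
    using H.ord_dvd_group_order[of x] x H by (simp add: ord_subgroup order_def)
  moreover have "ord x \<noteq> 1" using x xG ord_eq_1 by blast
  ultimately have "ord x = p" using p(1) by (meson prime_nat_iff)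
  then show ?thesis using that xG by blast
qed

lemma nilpotent_ord_prime_mult:
  assumes "nilpotent G" "finite (carrier G)" "Factorial_Ring.prime p" "Factorial_Ring.prime q" "p \<noteq> q"
    and "p dvd order G" "q dvd order G"
  obtains x where "x \<in> carrier G" "ord x = p * q"
proof -
  obtain x where x: "x \<in> carrier G" "ord x = p"
    using cauchy_prime_order[of p] assms by metis
  obtain y where y: "y \<in> carrier G" "ord y = q"
    using cauchy_prime_order[of q] assms by metis
  have cop: "coprime (ord x) (ord y)"
    using assms primes_coprime x y by blast
  have "x \<otimes> y = y \<otimes> x"
    using assms(1) x(1) y(1) cop by (rule nilpotent_coprime_ord_commute)
  then have "ord (x \<otimes> y) = p * q"
    using ord_mult_coprime x y cop by simp
  then show ?thesis
    using that[of "x \<otimes> y"] x y by blast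
qed

text \<open>
  The order of a coset divides the order of each of its elements, so a suitable power of any
  representative works. That power need not lie in the given coset.
\<close>

lemma ord_lift_quotient:
  assumes "finite (carrier G)" and N: "N \<lhd> G" and X: "X \<in> carrier (G Mod N)"
  obtains x where "x \<in> carrier G" "ord x = group.ord (G Mod N) X"
proof -
  obtain y where y: "y \<in> carrier G" "X = N #> y"
    using X by (auto simp: FactGroup_def RCOSETS_def)
  let ?d = "group.ord (G Mod N) X"
  obtain k where k: "ord y = ?d * k"
    using ord_rcoset_dvd[OF N y(1)] y(2) by auto
  have "ord y \<ge> 1"
    using assms(1) y(1) by (rule ord_ge_1)
  then have "k \<noteq> 0" "?d \<noteq> 0" using k by (auto intro: Nat.gr0I)
  then have "ord (y [^] k) = ?d"
    using ord_pow[OF y(1), of k] k by simp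
  then show ?thesis using that y by blast
qed

lemma metanilpotent_bipartite_complement:
  assumes fin: "finite (carrier G)" and "metanilpotent G"
  shows "bipartite (complement_graph (prime_graph G))"
proof -
  obtain N where N: "N \<lhd> G" and nilN: "nilpotent (G\<lparr>carrier := N\<rparr>)" and nilQ: "nilpotent (G Mod N)"
    using assms by (auto simp: metanilpotent_def)
  interpret N: normal N G by (rule N)
  have subN: "subgroup N G" by (rule N.subgroup_axioms)
  interpret Ng: group "G\<lparr>carrier := N\<rparr>" using subN subgroup_imp_group by blast
  interpret Q: group "G Mod N" by (rule N.factorgroup_is_group)
  have ord: "order (G Mod N) * card N = order G"
    using lagrange[OF subN] by (simp add: order_def FactGroup_def)
  have finN: "finite N" using fin N.subset finite_subset by blast
  have finQ: "finite (carrier (G Mod N))"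
    using ord fin order_gt_0_iff_finite Q.order_gt_0_iff_finite by fastforce
  let ?V = "{p. Factorial_Ring.prime p \<and> p dvd order G}"
  have *: "\<exists>x\<in>carrier G. ord x = p * q"
    if pq: "p \<in> ?V" "q \<in> ?V" "p \<noteq> q" and same: "p dvd card N \<longleftrightarrow> q dvd card N" for p q
  proof (cases "p dvd card N")
    case True
    with same have "p dvd order (G\<lparr>carrier := N\<rparr>)" "q dvd order (G\<lparr>carrier := N\<rparr>)"
      by (simp_all add: order_def)
    moreover have "finite (carrier (G\<lparr>carrier := N\<rparr>))"
      using finN by simp
    ultimately obtain x where "x \<in> carrier (G\<lparr>carrier := N\<rparr>)"
      "group.ord (G\<lparr>carrier := N\<rparr>) x = p * q"
      using Ng.nilpotent_ord_prime_mult[OF nilN, of p q] pq by blast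
    then show ?thesis using ord_subgroup[OF subN] N.mem_carrier by auto
  next
    case False
    then have "p dvd order (G Mod N)" "q dvd order (G Mod N)"
      using pq same prime_dvd_mult_nat by (auto simp flip: ord)
    then obtain X where "X \<in> carrier (G Mod N)" "group.ord (G Mod N) X = p * q"
      using Q.nilpotent_ord_prime_mult[OF nilQ finQ, of p q] pq by blast
    then show ?thesis using ord_lift_quotient[OF fin N] by metis
  qed
  show ?thesis
    unfolding bipartite_def
  proof (intro exI conjI)
    show "parcs (complement_graph (prime_graph G)) \<subseteq>
      {p \<in> ?V. p dvd card N} \<times> {p \<in> ?V. \<not> p dvd card N} \<union>
      {p \<in> ?V. \<not> p dvd card N} \<times> {p \<in> ?V. p dvd card N}"
      using * by (auto simp: complement_graph_def prime_graph_def Let_def)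
  qed (auto simp: complement_graph_def prime_graph_def Let_def)
qed

end

section \<open>Primes with a residue of prescribed order\<close>

text \<open>
  Take a base \<open>a\<close> divisible by \<open>n\<close> and by all numbers up to \<open>M\<close>, so that no prime divisor \<open>p\<close> of \<open>a ^ n - 1\<close>
  divides \<open>n\<close> or is at most \<open>M\<close>. If the order of \<open>a\<close> modulo \<open>p\<close> is a proper divisor of \<open>n\<close>, it divides
  \<open>m = n div q\<close> for some prime \<open>q\<close>. The cofactor of \<open>a ^ m - 1\<close> in \<open>a ^ n - 1\<close> is then \<open>q\<close> modulo \<open>p\<close>, hence
  prime to \<open>p\<close>, and \<open>p\<close> has the same multiplicity in both numbers. If this happened for every \<open>p\<close>,
  \<open>a ^ n - 1\<close> would divide the product of the \<open>a ^ (n div q) - 1\<close>, which by the hypothesis on \<open>n\<close> is at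
  most \<open>a ^ (n - 1)\<close> and hence smaller than \<open>a ^ n - 1\<close>.
\<close>

lemma exists_prime_with_given_order:
  fixes n M :: nat
  assumes n: "n > 0" and small: "(\<Sum>q\<in>prime_factors n. n div q) < n"
  obtains p a where "Factorial_Ring.prime p" "p > M" "Pocklington.ord p a = n"
proof (rule ccontr)
  note found = that
  assume "\<not> thesis"
  then have no: "Pocklington.ord p a \<noteq> n" if "Factorial_Ring.prime p" "p > M" for p a
    using that found by blast
  \<comment> \<open>The factor 3 makes the final inequality strict even when \<open>n\<close> and \<open>M\<close> are small.\<close>
  define a where "a = 3 * n * fact M"
  have a: "a \<ge> 3" using n by (simp add: a_def)
  define B where "B = (\<Prod>q\<in>prime_factors n. a ^ (n div q) - 1)"
  have pos: "a ^ m - 1 > 0" if "m > 0" for m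
    using one_less_power[of a m] a that by simp
  have divpos: "n div q > 0" if "q \<in> prime_factors n" for q
    using that n by (auto simp: div_greater_zero_iff in_prime_factors_iff intro: dvd_imp_le)
  have Bpos: "B > 0"
    unfolding B_def using divpos pos by (intro prod_pos) auto
  have "a ^ n - 1 dvd B"
  proof (rule multiplicity_le_imp_dvd)
    show "a ^ n - 1 \<noteq> 0" using pos[OF n] by simp
    fix p :: nat assume p: "Factorial_Ring.prime p"
    show "multiplicity p (a ^ n - 1) \<le> multiplicity p B"
    proof (cases "p dvd a ^ n - 1")
      case False
      then show ?thesis by (simp add: not_dvd_imp_multiplicity_0)
    next
      case True
      have "\<not> p dvd a"
      proof
        assume "p dvd a"
        then have "p dvd a ^ n" using n by (simp add: dvd_power_iff dvd_trans dvd_power)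
        then have "p dvd 1" using True a by (metis dvd_diffD1 n one_le_power order_trans one_le_numeral)
        then show False using p by auto
      qed
      then have pM: "p > M" and pn: "\<not> p dvd n"
        using p dvd_fact[of p M] prime_ge_1_nat[OF p] by (auto simp: a_def not_le[symmetric])
      have cong: "[a ^ m = 1] (mod p) \<longleftrightarrow> p dvd a ^ m - 1" for m
        using a by (simp add: cong_altdef_nat)
      have "Pocklington.ord p a dvd n"
        using True cong[of n] ord_divides[of a n p] by blast
      moreover have "Pocklington.ord p a \<noteq> n" using no p pM by blast
      ultimately obtain k where k: "n = Pocklington.ord p a * k" "k \<noteq> 1" by (metis dvdE mult.right_neutral)
      then obtain q where q: "Factorial_Ring.prime q" "q dvd k" using prime_factor_nat by blast
      have qn: "q \<in> prime_factors n" using q k n by (auto simp: in_prime_factors_iff)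
      define m where "m = n div q"
      have nm: "n = m * q" using q k by (auto simp: m_def)
      have "Pocklington.ord p a dvd m" using q k by (auto simp: m_def prime_gt_0_nat)
      then have m: "[a ^ m = 1] (mod p)" using ord_divides by blast
      define S where "S = (\<Sum>i<q. (a ^ m) ^ i)"
      have S: "a ^ n - 1 = (a ^ m - 1) * S"
      proof -
        have "int (a ^ n - 1) = int ((a ^ m - 1) * S)"
          using a unfolding S_def nm power_mult
          by (simp add: of_nat_diff power_diff_1_eq)
        then show ?thesis by linarith
      qed
      have "[S = (\<Sum>i<q. 1 ^ i)] (mod p)"
        unfolding S_def using m by (intro cong_sum cong_pow)
      then have "p dvd S \<longleftrightarrow> p dvd q" by (simp add: cong_dvd_iff)
      then have pS: "\<not> p dvd S" using pn nm by auto
      have "multiplicity p (a ^ n - 1) = multiplicity p (a ^ m - 1)"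
        using S pS p pos[OF n] by (simp add: prime_elem_multiplicity_mult_distrib not_dvd_imp_multiplicity_0)
      also have "a ^ m - 1 dvd B"
        unfolding B_def m_def using qn by (intro dvd_prodI) auto
      then have "multiplicity p (a ^ m - 1) \<le> multiplicity p B"
        using Bpos by (intro dvd_imp_multiplicity_le) auto
      finally show ?thesis .
    qed
  qed
  then have "a ^ n - 1 \<le> B" using Bpos by (rule dvd_imp_le)
  also have "B \<le> (\<Prod>q\<in>prime_factors n. a ^ (n div q))"
    unfolding B_def by (intro prod_mono) auto
  also have "\<dots> = a ^ (\<Sum>q\<in>prime_factors n. n div q)" by (simp add: power_sum)
  also have "\<dots> \<le> a ^ (n - 1)"
    using small a by (intro power_increasing) auto
  finally have "a ^ n - 1 \<le> a ^ (n - 1)" .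
  moreover have "a ^ n = a * a ^ (n - 1)" using n by (metis power_eq_if less_irrefl)
  moreover have "3 * a ^ (n - 1) \<le> a * a ^ (n - 1)" using a by (intro mult_right_mono) auto
  moreover have "a ^ (n - 1) > 0" using a by simp
  ultimately show False by linarith
qed

lemma prime_factors_prod_primes:
  fixes f :: "'v \<Rightarrow> nat"
  assumes "finite A" "inj_on f A" "\<And>a. a \<in> A \<Longrightarrow> Factorial_Ring.prime (f a)"
  shows "prime_factors (\<Prod>a\<in>A. f a) = f ` A" "squarefree (\<Prod>a\<in>A. f a)"
proof -
  have nz: "(\<Prod>a\<in>A. f a) \<noteq> 0" using assms by (auto dest: prime_gt_0_nat)
  show "prime_factors (\<Prod>a\<in>A. f a) = f ` A"
  proof (intro equalityI subsetI)
    fix x assume "x \<in> prime_factors (\<Prod>a\<in>A. f a)"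
    then obtain a where "a \<in> A" "x dvd f a" "Factorial_Ring.prime x"
      using assms(1) by (auto simp: in_prime_factors_iff prime_dvd_prod_iff)
    then show "x \<in> f ` A"
      using assms(3) primes_dvd_imp_eq by blast
  next
    fix x assume "x \<in> f ` A"
    then show "x \<in> prime_factors (\<Prod>a\<in>A. f a)"
      using assms nz by (auto simp: in_prime_factors_iff intro: dvd_prodI)
  qed
  show "squarefree (\<Prod>a\<in>A. f a)"
    using assms by (intro squarefree_prod_coprime squarefree_prime)
      (auto simp: primes_coprime inj_on_eq_iff)
qed

text \<open>
  Each of the \<open>card A\<close> cofactors is at most a fraction \<open>1 / (card A + 1)\<close> of the product.
\<close>

lemma sum_prime_cofactors_less:
  fixes f :: "'v \<Rightarrow> nat"
  assumes "finite A" "inj_on f A" "\<And>a. a \<in> A \<Longrightarrow> Factorial_Ring.prime (f a)"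
    and large: "\<And>a. a \<in> A \<Longrightarrow> card A < f a"
  shows "(\<Sum>q\<in>prime_factors (\<Prod>a\<in>A. f a). (\<Prod>a\<in>A. f a) div q) < (\<Prod>a\<in>A. f a)"
proof -
  let ?n = "\<Prod>a\<in>A. f a"
  have pos: "?n > 0" using assms by (intro prod_pos) (auto dest: prime_gt_0_nat)
  have "Suc (card A) * (?n div f a) \<le> ?n" if "a \<in> A" for a
  proof -
    have "Suc (card A) * (?n div f a) \<le> f a * (?n div f a)"
      using large[OF that] by (intro mult_right_mono) auto
    also have "\<dots> \<le> ?n" by simp
    finally show ?thesis .
  qed
  then have "(\<Sum>a\<in>A. Suc (card A) * (?n div f a)) \<le> (\<Sum>a\<in>A. ?n)"
    by (intro sum_mono)
  then have "Suc (card A) * (\<Sum>a\<in>A. ?n div f a) \<le> card A * ?n"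
    by (simp add: sum_distrib_left)
  also have "\<dots> < Suc (card A) * ?n" using pos by simp
  finally have "(\<Sum>a\<in>A. ?n div f a) < ?n" by (rule mult_less_cancel1[THEN iffD1, THEN conjunct2])
  then show ?thesis
    using assms by (simp add: prime_factors_prod_primes sum.reindex)
qed

section \<open>Semidirect products of two cyclic groups\<close>

lemma dvd_mult_cofactor_iff:
  fixes R d :: nat
  assumes "d dvd R" "R > 0"
  shows "R dvd n * (R div d) \<longleftrightarrow> d dvd n"
proof -
  obtain c where "R = d * c" "c > 0" using assms by auto
  then show ?thesis using assms by simp
qed

text \<open>
  The semidirect product of the residues modulo \<open>P\<close> by the residues modulo \<open>Q\<close>, where \<open>k\<close> acts as
  multiplication by \<open>r ^ k\<close>. The action is well defined if \<open>r ^ Q\<close> is 1 modulo \<open>P\<close>.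
\<close>

definition metacyclic :: "nat \<Rightarrow> nat \<Rightarrow> nat \<Rightarrow> (nat \<times> nat) monoid" where
  "metacyclic P Q r =
     \<lparr>carrier = {..<P} \<times> {..<Q},
      monoid.mult = (\<lambda>(x, k) (y, l). ((x + r ^ k * y) mod P, (k + l) mod Q)),
      one = (0, 0)\<rparr>"

locale metacyclic_group =
  fixes P Q r :: nat
  assumes P_pos: "P > 0" and Q_pos: "Q > 0" and r_pow_Q: "[r ^ Q = 1] (mod P)"
begin

abbreviation "G \<equiv> metacyclic P Q r"

lemma carrier_metacyclic: "carrier G = {..<P} \<times> {..<Q}"
  and mult_metacyclic: "(x, k) \<otimes>\<^bsub>G\<^esub> (y, l) = ((x + r ^ k * y) mod P, (k + l) mod Q)"
  and one_metacyclic: "\<one>\<^bsub>G\<^esub> = (0, 0)"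
  by (simp_all add: metacyclic_def)

lemma order_metacyclic: "order G = P * Q"
  by (simp add: order_def carrier_metacyclic card_cartesian_product)

lemma finite_metacyclic: "finite (carrier G)"
  by (simp add: carrier_metacyclic)

lemma pow_mod_Q: "[r ^ (k mod Q) = r ^ k] (mod P)"
proof -
  have "[(r ^ Q) ^ (k div Q) * r ^ (k mod Q) = 1 ^ (k div Q) * r ^ (k mod Q)] (mod P)"
    by (intro cong_mult cong_pow r_pow_Q cong_refl)
  then show ?thesis
    by (simp add: cong_sym_eq flip: power_mult power_add)
qed

lemma group_metacyclic: "group G"
proof (rule groupI)
  fix a b c assume "a \<in> carrier G" "b \<in> carrier G" "c \<in> carrier G"
  then obtain x k y l z m where abc: "a = (x, k)" "b = (y, l)" "c = (z, m)"
    by (cases a, cases b, cases c)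
  have "[(x + r ^ k * y) mod P + r ^ ((k + l) mod Q) * z = x + r ^ k * ((y + r ^ l * z) mod P)] (mod P)"
  proof -
    have "[(x + r ^ k * y) mod P + r ^ ((k + l) mod Q) * z = x + r ^ k * y + r ^ (k + l) * z] (mod P)"
      by (intro cong_add cong_mult pow_mod_Q cong_refl) (simp add: cong_def)
    also have "x + r ^ k * y + r ^ (k + l) * z = x + r ^ k * (y + r ^ l * z)"
      by (simp add: algebra_simps power_add)
    also have "[\<dots> = x + r ^ k * ((y + r ^ l * z) mod P)] (mod P)"
      by (intro cong_add cong_mult cong_refl) (simp add: cong_def)
    finally show ?thesis .
  qed
  then show "a \<otimes>\<^bsub>G\<^esub> b \<otimes>\<^bsub>G\<^esub> c = a \<otimes>\<^bsub>G\<^esub> (b \<otimes>\<^bsub>G\<^esub> c)"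
    unfolding abc mult_metacyclic cong_def by (simp add: mod_simps add.assoc)
next
  fix a assume a: "a \<in> carrier G"
  obtain x k where xk: "a = (x, k)" by (cases a)
  define l where "l = (Q - k) mod Q"
  define y where "y = (P - (r ^ l * x) mod P) mod P"
  have "(l + k) mod Q = 0"
    using a by (simp add: l_def xk carrier_metacyclic mod_simps)
  moreover have "(y + r ^ l * x) mod P = 0"
  proof -
    have "(y + r ^ l * x) mod P = (P - (r ^ l * x) mod P + (r ^ l * x) mod P) mod P"
      by (simp add: y_def mod_simps)
    also have "\<dots> = 0" using P_pos by (simp add: less_imp_le)
    finally show ?thesis .
  qed
  moreover have "(y, l) \<in> carrier G"
    using P_pos Q_pos by (simp add: carrier_metacyclic y_def l_def)
  ultimately show "\<exists>b\<in>carrier G. b \<otimes>\<^bsub>G\<^esub> a = \<one>\<^bsub>G\<^esub>"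
    unfolding xk by (auto simp: mult_metacyclic one_metacyclic intro!: bexI[of _ "(y, l)"])
qed (use P_pos Q_pos in \<open>auto simp: carrier_metacyclic mult_metacyclic one_metacyclic\<close>)

sublocale group G by (rule group_metacyclic)

lemma metacyclic_pow_snd: "snd (a [^]\<^bsub>G\<^esub> n) = (n * snd a) mod Q"
  by (induction n)
    (auto simp: one_metacyclic metacyclic_def case_prod_beta mod_simps algebra_simps)

lemma metacyclic_pow_fst: "(x, 0) [^]\<^bsub>G\<^esub> n = ((n * x) mod P, 0)"
  by (induction n) (auto simp: one_metacyclic mult_metacyclic mod_simps algebra_simps)

lemma metacyclic_pow_complement: "(0, k) [^]\<^bsub>G\<^esub> n = (0, (n * k) mod Q)"
  by (induction n) (auto simp: one_metacyclic mult_metacyclic mod_simps algebra_simps)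

lemma ord_kernel:
  assumes "d dvd P" "d > 1"
  shows "(P div d, 0) \<in> carrier G" "local.ord (P div d, 0) = d"
proof -
  show *: "(P div d, 0) \<in> carrier G"
    using assms P_pos Q_pos by (simp add: carrier_metacyclic)
  show "local.ord (P div d, 0) = d"
    using assms P_pos dvd_mult_cofactor_iff[of d P]
    by (subst ord_unique[OF *]) (auto simp: metacyclic_pow_fst one_metacyclic mod_eq_0_iff_dvd)
qed

lemma ord_complement:
  assumes "d dvd Q" "d > 1"
  shows "(0, Q div d) \<in> carrier G" "local.ord (0, Q div d) = d"
proof -
  show *: "(0, Q div d) \<in> carrier G"
    using assms P_pos Q_pos by (simp add: carrier_metacyclic)
  show "local.ord (0, Q div d) = d"
    using assms Q_pos dvd_mult_cofactor_iff[of d Q]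
    by (subst ord_unique[OF *]) (auto simp: metacyclic_pow_complement one_metacyclic mod_eq_0_iff_dvd)
qed

text \<open>
  Under the hypothesis the elements of order \<open>p\<close> and \<open>q\<close> from the two factors commute.
\<close>

lemma mixed_ord_if_fixed:
  assumes p: "Factorial_Ring.prime p" "p dvd P" and q: "Factorial_Ring.prime q" "q dvd Q" and "p \<noteq> q"
    and fixed: "[r ^ (Q div q) = 1] (mod p)"
  shows "\<exists>a\<in>carrier G. local.ord a = p * q"
proof -
  let ?x = "(P div p, 0)" and ?y = "(0, Q div q)"
  have p1: "p > 1" and q1: "q > 1" using p q prime_gt_1_nat by auto
  have "[r ^ (Q div q) * (P div p) = 1 * (P div p)] (mod p * (P div p))"
    using fixed unfolding cong_def mod_mult_mult2 by simp
  then have "[r ^ (Q div q) * (P div p) = P div p] (mod P)"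
    using p by simp
  then have "?x \<otimes>\<^bsub>G\<^esub> ?y = ?y \<otimes>\<^bsub>G\<^esub> ?x"
    by (simp add: mult_metacyclic cong_def)
  moreover have "coprime (local.ord ?x) (local.ord ?y)"
    using assms p1 q1 by (simp add: ord_kernel ord_complement primes_coprime)
  ultimately have "local.ord (?x \<otimes>\<^bsub>G\<^esub> ?y) = p * q"
    using ord_mult_coprime ord_kernel ord_complement p p1 q q1 by auto
  then show ?thesis
    using ord_kernel(1)[OF p(2) p1] ord_complement(1)[OF q(2) q1] m_closed by blast
qed

text \<open>
  Conversely, let \<open>a\<close> have order \<open>p * q\<close>. The power \<open>a\<^sup>q\<close> of order \<open>p\<close> lies in the kernel, because \<open>p\<close> is prime to
  \<open>Q\<close>, and \<open>a\<^sup>p\<close> of order \<open>q\<close> lies outside it, because \<open>q\<close> is prime to \<open>P\<close>. Comparing the two products of these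
  commuting elements shows that \<open>r ^ l\<close> is 1 modulo \<open>p\<close>, where \<open>l\<close> is the nonzero second component of \<open>a\<^sup>p\<close>.
  Since \<open>l\<close> and \<open>Q div q\<close> generate the same subgroup of the residues modulo \<open>Q\<close>, the same holds for
  the exponent \<open>Q div q\<close>.
\<close>

lemma fixed_if_mixed_ord:
  assumes cop: "coprime P Q" and p: "Factorial_Ring.prime p" "p dvd P"
    and q: "Factorial_Ring.prime q" "q dvd Q"
    and a: "a \<in> carrier G" "local.ord a = p * q"
  shows "[r ^ (Q div q) = 1] (mod p)"
proof -
  have p0: "p > 0" and q0: "q > 0" using p q prime_gt_0_nat by auto
  have p1: "p > 1" and q1: "q > 1" using p q prime_gt_1_nat by auto
  have pQ: "coprime p Q" and qP: "coprime q P"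
    using cop p q by (meson coprime_divisors dvd_refl coprime_commute)+
  obtain x k where u: "a [^]\<^bsub>G\<^esub> q = (x, k)" by fastforce
  obtain y l where v: "a [^]\<^bsub>G\<^esub> p = (y, l)" by fastforce
  have uG: "(x, k) \<in> carrier G" and vG: "(y, l) \<in> carrier G"
    using a by (simp_all flip: u v)
  have xP: "x < P" and lQ: "l < Q" using uG vG by (auto simp: carrier_metacyclic)
  have ou: "local.ord (x, k) = p" and ov: "local.ord (y, l) = q"
    using ord_pow[OF a(1), of q] ord_pow[OF a(1), of p] a p0 q0 by (simp_all flip: u v)
  have pow: "(x, k) [^]\<^bsub>G\<^esub> p = (0, 0)" "(y, l) [^]\<^bsub>G\<^esub> q = (0, 0)"
    using pow_ord_eq_1[OF uG] pow_ord_eq_1[OF vG] ou ov by (simp_all add: one_metacyclic)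
  have "Q dvd p * k"
    using metacyclic_pow_snd[of "(x, k)" p] pow by (simp add: mod_eq_0_iff_dvd)
  then have k: "k = 0"
    using uG pQ by (auto simp: carrier_metacyclic coprime_dvd_mult_right_iff coprime_commute dest: dvd_imp_le)
  have Pdvd: "P dvd p * x"
    using pow(1) by (simp add: k metacyclic_pow_fst mod_eq_0_iff_dvd)
  have x: "x \<noteq> 0"
  proof
    assume "x = 0"
    then show False using ou k ord_id p1 by (simp add: one_metacyclic)
  qed
  have Qdvd: "Q dvd q * l"
    using metacyclic_pow_snd[of "(y, l)" q] pow by (simp add: mod_eq_0_iff_dvd)
  have l: "l \<noteq> 0"
  proof
    assume l: "l = 0"
    then have "P dvd q * y"
      using pow(2) by (simp add: metacyclic_pow_fst mod_eq_0_iff_dvd)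
    then have "y = 0"
      using vG qP by (auto simp: carrier_metacyclic coprime_dvd_mult_right_iff coprime_commute dest: dvd_imp_le)
    then show False using ov l ord_id q1 by (simp add: one_metacyclic)
  qed
  have "(x, k) \<otimes>\<^bsub>G\<^esub> (y, l) = (y, l) \<otimes>\<^bsub>G\<^esub> (x, k)"
    using a by (simp add: nat_pow_mult add.commute flip: u v)
  then have "[y + x = y + r ^ l * x] (mod P)"
    by (simp add: mult_metacyclic k cong_def add.commute)
  then have comm: "[r ^ l * x = 1 * x] (mod P)"
    by (simp add: cong_add_lcancel_nat cong_sym_eq)
  obtain c where c: "P = p * c" using p by auto
  have "c dvd x" using Pdvd c p0 by simp
  then obtain j where j: "x = j * c" by (metis dvdE mult.commute)
  have c0: "c > 0" using c P_pos by auto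
  have "j < p" using xP c0 unfolding c j by simp
  then have "coprime j p"
    using x j p(1) by (metis coprime_commute nat_dvd_not_less prime_imp_coprime mult_is_0 neq0_conv)
  moreover have "[(r ^ l * j) * c = (1 * j) * c] (mod p * c)"
    using comm by (simp add: c j mult.assoc)
  then have "[r ^ l * j = 1 * j] (mod p)"
    using c0 by (simp add: cong_def mod_mult_mult2 flip: mult_mod_left)
  ultimately have rl: "[r ^ l = 1] (mod p)"
    by (metis cong_mult_rcancel_nat)
  have rQ: "[r ^ Q = 1] (mod p)"
    using r_pow_Q p(2) by (rule cong_dvd_modulus_nat)
  obtain d where d: "Q = q * d" using q by auto
  have "d dvd l" using Qdvd d q0 by simp
  then obtain i where i: "l = i * d" by (metis dvdE mult.commute)
  have d0: "d > 0" using d Q_pos by auto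
  have "i < q" using lQ d0 unfolding d i by simp
  then have "coprime i q"
    using l i q(1) by (metis coprime_commute nat_dvd_not_less prime_imp_coprime mult_is_0 neq0_conv)
  moreover have "Pocklington.ord p r dvd i * d" "Pocklington.ord p r dvd q * d"
    using rl rQ unfolding ord_divides by (simp_all add: d i)
  ultimately have "Pocklington.ord p r dvd d"
    using gcd_greatest[of "Pocklington.ord p r" "d * i" "d * q"]
    by (simp add: mult.commute flip: gcd_mult_distrib_nat)
  then show ?thesis using q0 unfolding d ord_divides by simp
qed

end

section \<open>Realizing graphs whose complement is bipartite\<close>

lemma prime_graph_image_group:
  assumes G: "group G" and f: "inj_on f (carrier G)"
  shows "prime_graph (image_group f G) = prime_graph G"
proof -
  interpret G: group G by fact
  interpret H: group "image_group f G" using f by (rule G.inj_imp_image_group_is_group)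
  interpret h: group_hom G "image_group f G" f
    using inj_imp_image_group_iso[OF f] by unfold_locales (auto simp: iso_def)
  have "group.ord (image_group f G) (f x) = group.ord G x" if x: "x \<in> carrier G" for x
  proof -
    have "f x [^]\<^bsub>image_group f G\<^esub> (n::nat) = \<one>\<^bsub>image_group f G\<^esub> \<longleftrightarrow> x [^]\<^bsub>G\<^esub> n = \<one>\<^bsub>G\<^esub>" for n
      using x f by (simp add: inj_on_eq_iff flip: h.hom_nat_pow h.hom_one)
    then show ?thesis
      by (simp add: H.ord_def G.ord_def)
  qed
  moreover have "order (image_group f G) = order G"
    using f by (simp add: order_def image_group_carrier card_image)
  ultimately show ?thesis
    by (simp add: prime_graph_def image_group_carrier)
qed

lemma digraph_iso_relabel:
  assumes F: "pair_graph F" and f: "inj_on f (pverts F)" and K: "pverts K = f ` pverts F"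
    and arcs: "\<And>u v. u \<in> pverts F \<Longrightarrow> v \<in> pverts F \<Longrightarrow> (f u, f v) \<in> parcs K \<longleftrightarrow> (u, v) \<in> parcs F"
    and sub: "parcs K \<subseteq> pverts K \<times> pverts K"
  shows "digraph_iso (with_proj K) (with_proj F)"
proof (rule digraph_iso_swap)
  interpret pair_graph F by fact
  show "wf_digraph (with_proj F)" by unfold_locales
  have ends: "parcs F \<subseteq> pverts F \<times> pverts F" using in_arcsD1 in_arcsD2 by auto
  let ?h = "\<lparr>iso_verts = f, iso_arcs = map_prod f f, iso_head = snd, iso_tail = fst\<rparr>"
  have "inj_on (map_prod f f) (parcs F)"
    using map_prod_inj_on[OF f f] ends inj_on_subset by blast
  then have "pre_digraph.digraph_isomorphism (with_proj F) ?h"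
    using f by (simp add: pre_digraph.digraph_isomorphism_def wf_digraph_axioms)
  moreover have "parcs K = map_prod f f ` parcs F"
  proof (intro equalityI subsetI)
    fix e assume e: "e \<in> parcs K"
    then obtain u v where uv: "e = (f u, f v)" "u \<in> pverts F" "v \<in> pverts F"
      using sub unfolding K by blast
    then have "(u, v) \<in> parcs F" using arcs e by simp
    then show "e \<in> map_prod f f ` parcs F" unfolding uv by (rule image_eqI[rotated]) simp
  next
    fix e assume "e \<in> map_prod f f ` parcs F"
    then obtain u v where uv: "e = (f u, f v)" "(u, v) \<in> parcs F" by auto
    then show "e \<in> parcs K" using arcs[of u v] ends by blast
  qed
  then have "with_proj K = app_iso ?h (with_proj F)"
    by (simp add: app_iso_def with_proj_def K)
  ultimately show "digraph_iso (with_proj F) (with_proj K)"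
    unfolding digraph_iso_def by blast
qed

lemma inj_into_infinite_set:
  assumes "finite A" "infinite S"
  obtains f where "inj_on f A" "f ` A \<subseteq> S"
proof -
  obtain B where "finite B" "card B = card A" "B \<subseteq> S"
    using infinite_arbitrarily_large[OF assms(2)] by blast
  then show ?thesis
    using finite_same_card_bij[OF assms(1)] that by (metis bij_betw_def)
qed

text \<open>
  The construction lives on pairs of residues; the pairing function of the natural numbers moves it
  to the type \<^typ>\<open>nat\<close>.
\<close>

lemma bipartite_complement_realizable:
  fixes F :: "'v pair_pre_digraph"
  assumes F: "pair_graph F" and "bipartite (complement_graph F)"
  obtains H :: "nat monoid" where "group H" "finite (carrier H)" "squarefree (order H)"
    "digraph_iso (with_proj (prime_graph H)) (with_proj F)"
proof -
  interpret F: pair_graph F by fact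
  obtain U W where UW: "pverts F = U \<union> W" "U \<inter> W = {}"
    and arcs: "parcs (complement_graph F) \<subseteq> U \<times> W \<union> W \<times> U"
    using assms(2) by (auto simp: bipartite_def complement_graph_def)
  have clique: "(u, v) \<in> parcs F" if "u \<noteq> v" "u \<in> U \<and> v \<in> U \<or> u \<in> W \<and> v \<in> W" for u v
    using that arcs UW by (auto simp: complement_graph_def)
  have loopfree: "(v, v) \<notin> parcs F" for v using F.pair_no_loops by fastforce
  have sym: "(u, v) \<in> parcs F \<longleftrightarrow> (v, u) \<in> parcs F" for u v
    using F.pair_sym_arcs by (auto simp: symmetric_def dest: symD)
  have finU: "finite U" and finW: "finite W"
    using F.pair_finite_verts UW by auto

  have "infinite ({p::nat. Factorial_Ring.prime p} - {..card W})"
    using primes_infinite by simp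
  \<comment> \<open>Labels exceeding \<open>card W\<close> have reciprocals that sum to less than 1.\<close>
  then obtain q where injq: "inj_on q W" and "q ` W \<subseteq> {p::nat. Factorial_Ring.prime p} - {..card W}"
    by (rule inj_into_infinite_set[OF finW])
  then have q: "Factorial_Ring.prime (q w)" "q w > card W" if "w \<in> W" for w
    using that by auto
  define Q where "Q = (\<Prod>w\<in>W. q w)"
  have Qpos: "Q > 0" unfolding Q_def using q by (intro prod_pos) (auto dest: prime_gt_0_nat)
  have Qfac: "prime_factors Q = q ` W" and Qsf: "squarefree Q"
    unfolding Q_def using prime_factors_prod_primes[OF finW injq] q by auto
  have Qsmall: "(\<Sum>q\<in>prime_factors Q. Q div q) < Q"
    unfolding Q_def using finW injq q by (rule sum_prime_cofactors_less)

  \<comment> \<open>The bound \<open>p > Q\<close> keeps the labels of \<open>U\<close> different from those of \<open>W\<close>.\<close>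
  let ?S = "{p. Factorial_Ring.prime p \<and> p > Q \<and> (\<exists>a. Pocklington.ord p a = Q)}"
  have "infinite ?S"
    unfolding infinite_nat_iff_unbounded
  proof
    fix M
    obtain p a where "Factorial_Ring.prime p" "p > max M Q" "Pocklington.ord p a = Q"
      using exists_prime_with_given_order[OF Qpos Qsmall] .
    then show "\<exists>p>M. p \<in> ?S" by auto
  qed
  then obtain p where injp: "inj_on p U" and "p ` U \<subseteq> ?S"
    by (rule inj_into_infinite_set[OF finU])
  then have p: "Factorial_Ring.prime (p u)" "p u > Q" and "\<exists>a. Pocklington.ord (p u) a = Q"
    if "u \<in> U" for u
    using that by auto
  then obtain a where a: "Pocklington.ord (p u) (a u) = Q" if "u \<in> U" for u
    by metis
  define P where "P = (\<Prod>u\<in>U. p u)"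
  have Ppos: "P > 0" unfolding P_def using p by (intro prod_pos) (auto dest: prime_gt_0_nat)
  have Pfac: "prime_factors P = p ` U" and Psf: "squarefree P"
    unfolding P_def using prime_factors_prod_primes[OF finU injp] p by auto
  have pcop: "coprime (p u) (p v)" if "u \<in> U" "v \<in> U" "u \<noteq> v" for u v
    using that p injp by (auto simp: primes_coprime inj_on_eq_iff)
  have disj: "p u \<noteq> q w" if "u \<in> U" "w \<in> W" for u w
  proof -
    have "q w dvd Q" using Qfac that by (auto simp: in_prime_factors_iff)
    then have "q w \<le> Q" using Qpos by (rule dvd_imp_le)
    then show ?thesis using p[OF that(1)] by simp
  qed
  have PQcop: "coprime P Q"
    unfolding P_def Q_def using p q disj by (intro prod_coprime_left prod_coprime_right primes_coprime) auto

  \<comment> \<open>This exponent makes \<open>q w\<close> act trivially modulo \<open>p u\<close> for the neighbours \<open>w\<close> of \<open>u\<close> only.\<close>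
  define e where "e u = (\<Prod>w\<in>{w \<in> W. (u, w) \<in> parcs F}. q w)" for u
  obtain r where r: "[r = a u ^ e u] (mod p u)" if "u \<in> U" for u
    using chinese_remainder_nat[OF finU, of p "\<lambda>u. a u ^ e u"] pcop by blast
  have rpow: "[r ^ l = 1] (mod p u) \<longleftrightarrow> Q dvd e u * l" if "u \<in> U" for u l
  proof -
    have "[r ^ l = (a u ^ e u) ^ l] (mod p u)"
      using r[OF that] by (rule cong_pow)
    then have "[r ^ l = 1] (mod p u) \<longleftrightarrow> [a u ^ (e u * l) = 1] (mod p u)"
      by (simp add: cong_def power_mult)
    then show ?thesis using ord_divides[of "a u" "e u * l" "p u"] a[OF that] by simp
  qed
  have "[r ^ Q = 1] (mod P)"
    unfolding P_def using pcop
    by (rule coprime_cong_prod_nat) (use rpow dvd_triv_right in blast)+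
  then interpret metacyclic_group P Q r
    using Ppos Qpos by unfold_locales
  have mixed: "(\<exists>x\<in>carrier G. local.ord x = p u * q w) \<longleftrightarrow> (u, w) \<in> parcs F"
    if u: "u \<in> U" and w: "w \<in> W" for u w
  proof -
    have pu: "Factorial_Ring.prime (p u)" "p u dvd P"
      using Pfac u by (auto simp: in_prime_factors_iff)
    have qw: "Factorial_Ring.prime (q w)" "q w dvd Q"
      using Qfac w by (auto simp: in_prime_factors_iff)
    have "(\<exists>x\<in>carrier G. local.ord x = p u * q w) \<longleftrightarrow> [r ^ (Q div q w) = 1] (mod p u)"
      using mixed_ord_if_fixed[OF pu qw] fixed_if_mixed_ord[OF PQcop pu qw] disj[OF u w] by blast
    also have "\<dots> \<longleftrightarrow> Q dvd e u * (Q div q w)" by (rule rpow[OF u])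
    also have "\<dots> \<longleftrightarrow> q w dvd e u"
      using dvd_mult_cofactor_iff[OF qw(2) Qpos] prime_gt_1_nat[OF qw(1)] by simp
    also have "\<dots> \<longleftrightarrow> (\<exists>w'\<in>W. (u, w') \<in> parcs F \<and> q w dvd q w')"
      using qw finW by (auto simp: e_def prime_dvd_prod_iff)
    also have "\<dots> \<longleftrightarrow> (u, w) \<in> parcs F"
      using q qw w injq by (metis dvd_refl inj_on_eq_iff primes_dvd_imp_eq)
    finally show ?thesis .
  qed
  have within: "\<exists>x\<in>carrier G. local.ord x = s * t"
    if "Factorial_Ring.prime s" "Factorial_Ring.prime t" "s \<noteq> t" "s dvd P \<and> t dvd P \<or> s dvd Q \<and> t dvd Q" for s t
  proof -
    have "s * t > 1" using that(1,2) by (metis less_1_mult prime_gt_1_nat)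
    moreover have "s * t dvd P \<or> s * t dvd Q"
      using that by (metis divides_mult primes_coprime)
    ultimately show ?thesis using ord_kernel ord_complement by blast
  qed
  define f where "f v = (if v \<in> U then p v else q v)" for v
  have fU: "f u = p u" if "u \<in> U" for u using that by (simp add: f_def)
  have fW: "f w = q w" if "w \<in> W" for w using that UW by (auto simp: f_def)
  have inj: "inj_on f (pverts F)"
    unfolding UW inj_on_def using fU fW injp injq disj by (metis Un_iff inj_on_eq_iff)
  have verts: "pverts (prime_graph G) = f ` pverts F"
  proof -
    have "pverts (prime_graph G) = prime_factors (P * Q)"
      using Ppos Qpos by (auto simp: prime_graph_def order_metacyclic in_prime_factors_iff)
    also have "\<dots> = p ` U \<union> q ` W"
      using Ppos Qpos by (simp add: prime_factors_product Pfac Qfac)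
    also have "\<dots> = f ` pverts F"
      by (simp add: UW image_Un fU fW)
    finally show ?thesis .
  qed
  have edges: "(f u, f v) \<in> parcs (prime_graph G) \<longleftrightarrow>
      u \<noteq> v \<and> (\<exists>x\<in>carrier G. local.ord x = f u * f v)"
    if "u \<in> pverts F" "v \<in> pverts F" for u v
  proof -
    have "f u \<in> pverts (prime_graph G)" "f v \<in> pverts (prime_graph G)"
      using that verts by auto
    then show ?thesis
      using that inj by (auto simp: prime_graph_def Let_def inj_on_eq_iff)
  qed
  have iso: "digraph_iso (with_proj (prime_graph G)) (with_proj F)"
  proof (rule digraph_iso_relabel[OF F inj verts])
    fix u v assume uv: "u \<in> pverts F" "v \<in> pverts F"
    have dvdP: "Factorial_Ring.prime (f u) \<and> f u dvd P" if "u \<in> U" for u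
      using that Pfac by (auto simp: fU in_prime_factors_iff)
    have dvdQ: "Factorial_Ring.prime (f w) \<and> f w dvd Q" if "w \<in> W" for w
      using that Qfac by (auto simp: fW in_prime_factors_iff)
    consider "u = v" | "u \<noteq> v" "u \<in> U \<and> v \<in> U \<or> u \<in> W \<and> v \<in> W"
      | "u \<in> U" "v \<in> W" | "u \<in> W" "v \<in> U"
      using uv UW by blast
    then show "(f u, f v) \<in> parcs (prime_graph G) \<longleftrightarrow> (u, v) \<in> parcs F"
    proof cases
      case 1
      then show ?thesis using edges uv loopfree by simp
    next
      case 2
      then have "f u \<noteq> f v" using uv inj by (simp add: inj_on_eq_iff)
      then show ?thesis
        using 2 edges[OF uv] clique[OF 2] within[of "f u" "f v"] dvdP dvdQ by blast
    next
      case 3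
      then show ?thesis using edges[OF uv] mixed[of u v] UW by (auto simp: fU fW)
    next
      case 4
      then show ?thesis
        using edges[OF uv] mixed[of v u] UW sym[of u v] by (auto simp: fU fW mult.commute)
    qed
  qed (auto simp: prime_graph_def Let_def)
  have inj_enc: "inj_on prod_encode (carrier G)"
    by (rule inj_prod_encode)
  show thesis
  proof (rule that)
    show "group (image_group prod_encode G)"
      using inj_enc by (rule inj_imp_image_group_is_group)
    show "finite (carrier (image_group prod_encode G))"
      by (simp add: image_group_carrier finite_metacyclic)
    have "order (image_group prod_encode G) = P * Q"
      using inj_enc by (simp add: order_def image_group_carrier card_image flip: order_metacyclic)
    then show "squarefree (order (image_group prod_encode G))"
      using Psf Qsf PQcop by (simp add: squarefree_mult_coprime)
    show "digraph_iso (with_proj (prime_graph (image_group prod_encode G))) (with_proj F)"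
      unfolding prime_graph_image_group[OF group_metacyclic inj_enc] by (rule iso)
  qed
qed

theorem theorem3p1:
  shows "(\<forall>G :: 'g monoid. group G \<and> finite (carrier G) \<and> metanilpotent G \<longrightarrow>
            bipartite (complement_graph (prime_graph G))) \<and>
         (\<forall>F :: 'v pair_pre_digraph. pair_graph F \<and> bipartite (complement_graph F) \<longrightarrow>
            (\<exists>H :: nat monoid. group H \<and> finite (carrier H) \<and> squarefree (order H) \<and>
               digraph_iso (with_proj (prime_graph H)) (with_proj F)))"
proof (rule conjI; intro allI impI; elim conjE)
  fix G :: "'g monoid"
  assume "group G" "finite (carrier G)" "metanilpotent G"
  then show "bipartite (complement_graph (prime_graph G))"
    by (rule group.metanilpotent_bipartite_complement)
next
  fix F :: "'v pair_pre_digraph"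
  assume "pair_graph F" "bipartite (complement_graph F)"
  then obtain H :: "nat monoid" where "group H" "finite (carrier H)" "squarefree (order H)"
    "digraph_iso (with_proj (prime_graph H)) (with_proj F)"
    by (rule bipartite_complement_realizable)
  then show "\<exists>H :: nat monoid. group H \<and> finite (carrier H) \<and> squarefree (order H) \<and>
      digraph_iso (with_proj (prime_graph H)) (with_proj F)"
    by (intro exI conjI)
qed

end
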